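(* Let $A:[0,1]^2\to[0,1]$ be an aggregation function that is left-continuous with respect to its second variable, has $1$ as a left neutral element (i.e. $A(1,x)=x$ for all $x$), and satisfies $A(0,y)=0$ for all $y<1$. Let $I_A(x,y)=\sup\{z\in[0,1]\mid A(x,z)\leq y\}$; then $I_A$ is a fuzzy implication. For nonempty sets $U,V$, fuzzy sets $D,D'$ on $U$ and $B$ on $V$, define $B'(y)=\sup_{x\in U}A(D'(x),I_A(D(x),B(y)))$. Then for all such $U,V,D,D',D'',B$ (with $B''$ the conclusion obtained from $D''$): (i) if $D'$ is normal, then $B\subseteq B'$; (ii) if $D'\subseteq D''$, then $B'\subseteq B''$; (iii) if $D^C$ is normal and $D'=D^C$, then $B'(y)=1$ for all $y$; (iv) if $D$ is normal and $D'=D$, then $B'=B$.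
   Context: An aggregation function is $A:[0,1]^2\to[0,1]$ non-decreasing in each variable with $A(0,0)=0$, $A(1,1)=1$. A fuzzy implication is a function $[0,1]^2\to[0,1]$ non-increasing in the first variable, non-decreasing in the second, with $I(0,0)=I(1,1)=1$, $I(1,0)=0$. Fuzzy sets on $U$ are maps $U\to[0,1]$; inclusion is pointwise; normal means attaining the value $1$; $D^C(x)=1-D(x)$. *)

theory Defs
  imports Complex_Main "HOL-Library.FuncSet"
begin

text \<open>
  Binary operations on the unit interval are functions on \<open>real\<close> that are only
  constrained on \<open>{0..1}\<close>; fuzzy sets on a carrier \<open>U\<close> are only constrained on \<open>U\<close>,
  so that equality of two fuzzy sets on \<open>U\<close> means agreement on \<open>U\<close>.
\<close>

definition aggregation_function :: "(real \<Rightarrow> real \<Rightarrow> real) \<Rightarrow> bool" where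
  "aggregation_function A \<longleftrightarrow>
     (\<forall>x\<in>{0..1}. \<forall>y\<in>{0..1}. A x y \<in> {0..1}) \<and>
     (\<forall>y\<in>{0..1}. mono_on {0..1} (\<lambda>x. A x y)) \<and>
     (\<forall>x\<in>{0..1}. mono_on {0..1} (\<lambda>y. A x y)) \<and>
     A 0 0 = 0 \<and> A 1 1 = 1"

definition fuzzy_implication :: "(real \<Rightarrow> real \<Rightarrow> real) \<Rightarrow> bool" where
  "fuzzy_implication I \<longleftrightarrow>
     (\<forall>x\<in>{0..1}. \<forall>y\<in>{0..1}. I x y \<in> {0..1}) \<and>
     (\<forall>y\<in>{0..1}. antimono_on {0..1} (\<lambda>x. I x y)) \<and>
     (\<forall>x\<in>{0..1}. mono_on {0..1} (\<lambda>y. I x y)) \<and>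
     I 0 0 = 1 \<and> I 1 1 = 1 \<and> I 1 0 = 0"

text \<open>
  At \<open>0\<close> there is no left neighbourhood inside the unit interval, so left-continuity
  is required exactly at the points of \<open>{0<..1}\<close>.
\<close>

definition left_continuous_snd :: "(real \<Rightarrow> real \<Rightarrow> real) \<Rightarrow> bool" where
  "left_continuous_snd A \<longleftrightarrow>
     (\<forall>x\<in>{0..1}. \<forall>y\<in>{0<..1}. continuous (at_left y) (\<lambda>z. A x z))"

text \<open>
  The set below is nonempty for \<open>x, y\<close> in the unit interval as soon as \<open>A x 0 = 0\<close>,
  which holds for a monotone \<open>A\<close> with left neutral element \<open>1\<close>; the
  unspecified value of \<open>Sup {}\<close> on \<open>real\<close> then plays no role.
\<close>

definition residual :: "(real \<Rightarrow> real \<Rightarrow> real) \<Rightarrow> real \<Rightarrow> real \<Rightarrow> real" where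
  "residual A x y = Sup {z \<in> {0..1}. A x z \<le> y}"

definition fuzzy_sets :: "'a set \<Rightarrow> ('a \<Rightarrow> real) set" where
  "fuzzy_sets U = U \<rightarrow> {0..1}"

definition fuzzy_subset :: "'a set \<Rightarrow> ('a \<Rightarrow> real) \<Rightarrow> ('a \<Rightarrow> real) \<Rightarrow> bool" where
  "fuzzy_subset U D E \<longleftrightarrow> (\<forall>x\<in>U. D x \<le> E x)"

definition fuzzy_normal :: "'a set \<Rightarrow> ('a \<Rightarrow> real) \<Rightarrow> bool" where
  "fuzzy_normal U D \<longleftrightarrow> (\<exists>x\<in>U. D x = 1)"

definition fuzzy_compl :: "('a \<Rightarrow> real) \<Rightarrow> 'a \<Rightarrow> real" where
  "fuzzy_compl D = (\<lambda>x. 1 - D x)"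

text \<open>
  The compositional rule of inference for the rule ``if \<open>D\<close> then \<open>B\<close>'', modelled by
  the implication \<open>I\<close>, applied to the input \<open>D'\<close>.
\<close>

definition cri ::
  "(real \<Rightarrow> real \<Rightarrow> real) \<Rightarrow> (real \<Rightarrow> real \<Rightarrow> real) \<Rightarrow> 'u set \<Rightarrow>
   ('u \<Rightarrow> real) \<Rightarrow> ('v \<Rightarrow> real) \<Rightarrow> ('u \<Rightarrow> real) \<Rightarrow> 'v \<Rightarrow> real" where
  "cri A I U D B D' = (\<lambda>y. SUP x\<in>U. A (D' x) (I (D x) (B y)))"

end

theory Submission
  imports Defs
begin

text \<open>
  Monotonicity and the left neutral element give \<open>A x 0 = 0\<close>, so the set defining \<open>residual A x y\<close>
  contains \<open>0\<close>, and left-continuity yields modus ponens \<open>A x (residual A x y) \<le> y\<close>.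
  Moreover \<open>residual A 1 y = y\<close> because \<open>1\<close> is left neutral, and \<open>residual A 0 y = 1\<close> because
  \<open>A 0 z = 0\<close> for \<open>z < 1\<close>. Part (iv) is modus ponens plus attainment at a point where \<open>D = 1\<close>; parts (i) and
  (iii) only evaluate the supremum at one point where \<open>D' = 1\<close>.
\<close>

locale residuated_aggregation =
  fixes A :: "real \<Rightarrow> real \<Rightarrow> real"
  assumes aggregation: "aggregation_function A"
    and left_continuous: "left_continuous_snd A"
    and left_neutral: "x \<in> {0..1} \<Longrightarrow> A 1 x = x"
    and zero_left: "y \<in> {0..<1} \<Longrightarrow> A 0 y = 0"
begin

lemma A_range: "x \<in> {0..1} \<Longrightarrow> y \<in> {0..1} \<Longrightarrow> A x y \<in> {0..1}"
  using aggregation unfolding aggregation_function_def by blast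

lemma A_mono:
  assumes "x \<in> {0..1}" "x' \<in> {0..1}" "y \<in> {0..1}" "y' \<in> {0..1}" "x \<le> x'" "y \<le> y'"
  shows "A x y \<le> A x' y'"
proof -
  have "A x y \<le> A x' y"
    using aggregation assms unfolding aggregation_function_def mono_on_def by blast
  also have "\<dots> \<le> A x' y'"
    using aggregation assms unfolding aggregation_function_def mono_on_def by blast
  finally show ?thesis .
qed

lemma A_zero_right:
  assumes "x \<in> {0..1}" shows "A x 0 = 0"
proof -
  have "A x 0 \<le> A 1 0"
    using A_mono[of x 1 0 0] assms by simp
  then show ?thesis
    using left_neutral[of 0] A_range[of x 0] assms by simp
qed

lemma zero_mem_residual_set:
  assumes "x \<in> {0..1}" "y \<in> {0..1}"
  shows "0 \<in> {z \<in> {0..1}. A x z \<le> y}"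
  using assms A_zero_right by simp

lemma bdd_above_residual_set: "bdd_above {z \<in> {0..1}. A x z \<le> y}"
  by (rule bdd_aboveI[of _ 1]) simp

lemma residual_upper: "z \<in> {0..1} \<Longrightarrow> A x z \<le> y \<Longrightarrow> z \<le> residual A x y"
  unfolding residual_def by (intro cSup_upper bdd_above_residual_set) simp

text \<open>The range conditions on \<open>x\<close> and \<open>y\<close> make the defining set
  nonempty, so that its supremum is a genuine least upper bound.\<close>

lemma residual_le:
  assumes "x \<in> {0..1}" "y \<in> {0..1}" and "\<And>z. z \<in> {0..1} \<Longrightarrow> A x z \<le> y \<Longrightarrow> z \<le> c"
  shows "residual A x y \<le> c"
  unfolding residual_def using zero_mem_residual_set[OF assms(1,2)] assms(3)
  by (intro cSup_least) blast+

lemma residual_range: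
  assumes "x \<in> {0..1}" "y \<in> {0..1}" shows "residual A x y \<in> {0..1}"
  using residual_le[OF assms, of 1] residual_upper[of 0 x y] zero_mem_residual_set[OF assms]
  by simp

text \<open>Lowering the first argument and raising the second enlarges the set of admissible
  \<open>z\<close>, because \<open>A\<close> is monotone in its first argument.\<close>

lemma residual_mono:
  assumes "x \<in> {0..1}" "x' \<in> {0..1}" "y \<in> {0..1}" "y' \<in> {0..1}" "x' \<le> x" "y \<le> y'"
  shows "residual A x y \<le> residual A x' y'"
proof (rule residual_le[OF assms(1,3)])
  fix z assume z: "z \<in> {0..1}" "A x z \<le> y"
  have "A x' z \<le> A x z"
    using A_mono z(1) assms by blast
  then show "z \<le> residual A x' y'"
    using z assms(6) by (intro residual_upper) auto
qed

lemma residual_one_left: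
  assumes "y \<in> {0..1}" shows "residual A 1 y = y"
proof (rule antisym)
  show "residual A 1 y \<le> y"
    using assms left_neutral by (intro residual_le) auto
  show "y \<le> residual A 1 y"
    using assms left_neutral by (intro residual_upper) auto
qed

lemma residual_zero_left:
  assumes "y \<in> {0..1}" shows "residual A 0 y = 1"
proof (rule antisym)
  show "residual A 0 y \<le> 1"
    using residual_range[of 0 y] assms by simp
  show "1 \<le> residual A 0 y"
  \<comment> \<open>\<open>zero_left\<close> covers only arguments below 1, so 1 is not tested for
    admissibility itself but reached through all \<open>w\<close> strictly between 0 and 1.\<close>
  proof (rule dense_le_bounded)
    fix w :: real assume "0 < w" "w < 1"
    then show "w \<le> residual A 0 y"
      using zero_left[of w] assms by (intro residual_upper) auto
  qed simp
qed

lemma fuzzy_implication_residual: "fuzzy_implication (residual A)"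
  unfolding fuzzy_implication_def
  using residual_range residual_zero_left residual_one_left
  by (auto intro!: monotone_onI residual_mono)

lemma modus_ponens:
  assumes x: "x \<in> {0..1}" and y: "y \<in> {0..1}"
  shows "A x (residual A x y) \<le> y"
\<comment> \<open>Left-continuity says nothing at 0, so a vanishing residual is handled
  separately.\<close>
proof (cases "residual A x y = 0")
  case True
  then show ?thesis using A_zero_right[OF x] y by simp
next
  case False
  let ?s = "residual A x y"
  have s: "?s \<in> {0<..1}"
    using False residual_range[OF x y] by auto
  have below: "A x z \<le> y" if z: "0 < z" "z < ?s" for z
  proof -
    \<comment> \<open>Since \<open>z\<close> lies strictly below the supremum, it is not an upper
      bound; some admissible \<open>w\<close> exceeds it, and monotonicity makes \<open>z\<close>
      admissible too.\<close>
    obtain w where w: "w \<in> {0..1}" "A x w \<le> y" "z < w"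
      using residual_le[OF x y, of z] z(2) by (meson linorder_not_le)
    have "A x z \<le> A x w"
      using A_mono[of x x z w] x w z by simp
    then show ?thesis using w(2) by simp
  qed
  show ?thesis
  \<comment> \<open>The bound on the open interval from 0 to \<open>?s\<close> survives the limit
    from the left, and left-continuity identifies that limit as \<open>A x ?s\<close>.\<close>
  proof (rule tendsto_upperbound)
    show "((\<lambda>z. A x z) \<longlongrightarrow> A x ?s) (at_left ?s)"
      using left_continuous x s by (auto simp: left_continuous_snd_def continuous_within)
    show "\<forall>\<^sub>F z in at_left ?s. A x z \<le> y"
      using s below by (auto intro: eventually_at_leftI[of 0])
  qed simp
qed

text \<open>The inferred fuzzy set is computed pointwise in \<open>y\<close>, so only the single
  value \<open>B y\<close> has to lie in the unit interval and the carrier of \<open>B\<close> does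
  not occur.\<close>

context
  fixes U :: "'u set" and D :: "'u \<Rightarrow> real" and B :: "'v \<Rightarrow> real" and y :: 'v
  assumes D: "D \<in> fuzzy_sets U" and By: "B y \<in> {0..1}"
begin

lemma D_range: "x \<in> U \<Longrightarrow> D x \<in> {0..1}"
  using D unfolding fuzzy_sets_def by blast

lemma cri_term_range:
  assumes "D' \<in> fuzzy_sets U" "x \<in> U"
  shows "A (D' x) (residual A (D x) (B y)) \<in> {0..1}"
  using assms D_range By unfolding fuzzy_sets_def by (blast intro: A_range residual_range)

lemma cri_upper:
  assumes "D' \<in> fuzzy_sets U" "x \<in> U"
  shows "A (D' x) (residual A (D x) (B y)) \<le> cri A (residual A) U D B D' y"
  unfolding cri_def using assms cri_term_range[OF assms(1)]
  by (intro cSUP_upper bdd_aboveI2[of _ _ 1]) auto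

text \<open>Where \<open>D'\<close> is 1, left neutrality turns the outer \<open>A\<close> into the
  identity, so the term of the supremum is the residual itself.\<close>

lemma cri_upper_normal:
  assumes "D' \<in> fuzzy_sets U" "x \<in> U" "D' x = 1"
  shows "residual A (D x) (B y) \<le> cri A (residual A) U D B D' y"
  using cri_upper[OF assms(1,2)] left_neutral residual_range[OF D_range[OF assms(2)] By] assms(3)
  by simp

lemma cri_le:
  assumes "U \<noteq> {}" "\<And>x. x \<in> U \<Longrightarrow> A (D' x) (residual A (D x) (B y)) \<le> c"
  shows "cri A (residual A) U D B D' y \<le> c"
  unfolding cri_def using assms by (rule cSUP_least)

text \<open>The residual is antitone in its first argument, hence least at 1, where it equals
  \<open>B y\<close>; thus the value of \<open>D\<close> at the chosen point does not
  matter.\<close>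

lemma le_cri_normal:
  assumes "D' \<in> fuzzy_sets U" "fuzzy_normal U D'"
  shows "B y \<le> cri A (residual A) U D B D' y"
proof -
  obtain x where x: "x \<in> U" "D' x = 1"
    using assms(2) unfolding fuzzy_normal_def by blast
  have "B y = residual A 1 (B y)"
    using residual_one_left[OF By] by simp
  also have "\<dots> \<le> residual A (D x) (B y)"
    using residual_mono[of 1 "D x" "B y" "B y"] D_range[OF x(1)] By by simp
  also have "\<dots> \<le> cri A (residual A) U D B D' y"
    by (rule cri_upper_normal[OF assms(1) x])
  finally show ?thesis .
qed

text \<open>The residual in each term is independent of the input, so the terms compare by
  monotonicity of \<open>A\<close> in its first argument.\<close>

lemma cri_mono:
  assumes "U \<noteq> {}" "D' \<in> fuzzy_sets U" "D'' \<in> fuzzy_sets U" "fuzzy_subset U D' D''"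
  shows "cri A (residual A) U D B D' y \<le> cri A (residual A) U D B D'' y"
proof (rule cri_le[OF assms(1)])
  fix x assume x: "x \<in> U"
  have "A (D' x) (residual A (D x) (B y)) \<le> A (D'' x) (residual A (D x) (B y))"
    using assms x residual_range[OF D_range[OF x] By]
    by (intro A_mono) (auto simp: fuzzy_sets_def fuzzy_subset_def)
  also have "\<dots> \<le> cri A (residual A) U D B D'' y"
    by (rule cri_upper[OF assms(3) x])
  finally show "A (D' x) (residual A (D x) (B y)) \<le> cri A (residual A) U D B D'' y" .
qed

lemma cri_compl:
  assumes "D' \<in> fuzzy_sets U" "fuzzy_normal U (fuzzy_compl D)" "\<forall>x\<in>U. D' x = fuzzy_compl D x"
  shows "cri A (residual A) U D B D' y = 1"
proof (rule antisym)
  \<comment> \<open>A point where the complement is 1 has \<open>D x = 0\<close>, which makes the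
    residual there equal to 1.\<close>
  obtain x where x: "x \<in> U" "D x = 0" "D' x = 1"
    using assms(2,3) unfolding fuzzy_normal_def fuzzy_compl_def by auto
  show "1 \<le> cri A (residual A) U D B D' y"
    using cri_upper_normal[OF assms(1) x(1,3)] residual_zero_left[OF By] x(2) by simp
  show "cri A (residual A) U D B D' y \<le> 1"
    using x(1) cri_term_range[OF assms(1)] by (intro cri_le) auto
qed

lemma cri_same:
  assumes "D' \<in> fuzzy_sets U" "fuzzy_normal U D" "\<forall>x\<in>U. D' x = D x"
  shows "cri A (residual A) U D B D' y = B y"
proof (rule antisym)
  show "cri A (residual A) U D B D' y \<le> B y"
    using assms(2,3) modus_ponens[OF D_range By]
    by (intro cri_le) (auto simp: fuzzy_normal_def)
  \<comment> \<open>Agreement on \<open>U\<close> carries normality over from \<open>D\<close> to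
    \<open>D'\<close>.\<close>
  show "B y \<le> cri A (residual A) U D B D' y"
    using assms(2,3) by (intro le_cri_normal[OF assms(1)]) (auto simp: fuzzy_normal_def)
qed

end

end

theorem theorem4p6:
  fixes A :: "real \<Rightarrow> real \<Rightarrow> real"
  assumes "aggregation_function A"
    and "left_continuous_snd A"
    and "\<forall>x\<in>{0..1}. A 1 x = x"
    and "\<forall>y\<in>{0..<1}. A 0 y = 0"
  shows "fuzzy_implication (residual A) \<and>
    (\<forall>(U :: 'u set) (V :: 'v set).
      U \<noteq> {} \<longrightarrow> V \<noteq> {} \<longrightarrow>
      (\<forall>D\<in>fuzzy_sets U. \<forall>D'\<in>fuzzy_sets U. \<forall>D''\<in>fuzzy_sets U. \<forall>B\<in>fuzzy_sets V.
        let B' = cri A (residual A) U D B D';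
            B'' = cri A (residual A) U D B D''
        in (fuzzy_normal U D' \<longrightarrow> fuzzy_subset V B B') \<and>
           (fuzzy_subset U D' D'' \<longrightarrow> fuzzy_subset V B' B'') \<and>
           (fuzzy_normal U (fuzzy_compl D) \<and> (\<forall>x\<in>U. D' x = fuzzy_compl D x)
              \<longrightarrow> (\<forall>y\<in>V. B' y = 1)) \<and>
           (fuzzy_normal U D \<and> (\<forall>x\<in>U. D' x = D x) \<longrightarrow> (\<forall>y\<in>V. B' y = B y))))"
proof -
  interpret residuated_aggregation A
    using assms by unfold_locales auto
  show ?thesis
    unfolding Let_def
  proof (intro conjI allI impI ballI fuzzy_implication_residual)
    fix U :: "'u set" and V :: "'v set" and D D' D'' B
    assume U: "U \<noteq> {}" and D: "D \<in> fuzzy_sets U" and D': "D' \<in> fuzzy_sets U"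
      and D'': "D'' \<in> fuzzy_sets U" and "B \<in> fuzzy_sets V"
    \<comment> \<open>This is what lets each pointwise result be applied at every \<open>y\<close>
      in \<open>V\<close>.\<close>
    then have B: "B y \<in> {0..1}" if "y \<in> V" for y
      using that unfolding fuzzy_sets_def by blast
    show "fuzzy_subset V B (cri A (residual A) U D B D')" if "fuzzy_normal U D'"
      unfolding fuzzy_subset_def using le_cri_normal[where B = B, OF D B D' that] by blast
    show "fuzzy_subset V (cri A (residual A) U D B D') (cri A (residual A) U D B D'')"
      if "fuzzy_subset U D' D''"
      using cri_mono[where B = B, OF D B U D' D'' that] unfolding fuzzy_subset_def[of V] by blast
    show "cri A (residual A) U D B D' y = 1"
      if "fuzzy_normal U (fuzzy_compl D) \<and> (\<forall>x\<in>U. D' x = fuzzy_compl D x)" "y \<in> V" for y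
      using cri_compl[where B = B, OF D B D'] that by blast
    show "cri A (residual A) U D B D' y = B y"
      if "fuzzy_normal U D \<and> (\<forall>x\<in>U. D' x = D x)" "y \<in> V" for y
      using cri_same[where B = B, OF D B D'] that by blast
  qed
qed

end
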